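(* Let $r$ be a rational function with $\deg(r)\ge 2$ such that $f(z)=r(z)-\overline{z}$ is non-degenerate and $\lim_{|z|\to\infty}|f(z)|=\infty$. Assume $r'(0)=1$ (so that $0\in\mathcal{C}$), put $\eta := f(0)$, and suppose that $\eta$ is a simple fold point of $f$. Let $A_+,A_-\in\mathcal{A}$ be the two sets bordering the critical point $z=0$, i.e. $0\in\partial A_+\cap\partial A_-$, $A_+\subseteq\Omega_+$ and $A_-\subseteq\Omega_-$. Then there exists a nonzero $\widetilde{\eta}\in\mathbb{C}$ such that for all $0<\alpha\le 1$: (i) $N(f_{\eta+\alpha\widetilde{\eta}})=N(f_\eta)+1=N(f_{\eta-\alpha\widetilde{\eta}})+2$; (ii) $N(f_{\eta+\alpha\widetilde{\eta}};A)=N(f_\eta;A)=N(f_{\eta-\alpha\widetilde{\eta}};A)$ for all $A\in\mathcal{A}\setminus\{A_+,A_-\}$; (iii) $N(f_{\eta+\alpha\widetilde{\eta}};A_+)=N(f_{\eta-\alpha\widetilde{\eta}};A_+)+1$; (iv) $N(f_{\eta+\alpha\widetilde{\eta}};A_-)=N(f_{\eta-\alpha\widetilde{\eta}};A_-)+1$; (v) $N_s(f_{\eta+\alpha\widetilde{\eta}})=N_s(f_{\eta-\alpha\widetilde{\eta}})=0$ and $N_s(f_\eta)=1$.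
   Context: For $f(z)=r(z)-\overline{z}$ with $r=p/q$ rational ($p,q$ coprime polynomials), $\deg(r)=\max(\deg p,\deg q)$. The set of critical points of $f$ is $\mathcal{C}=\{z\in\mathbb{C}:|r'(z)|=1\}$; $\Omega_+$ is the region where $|r'|>1$ (including the poles of $r$; $f$ is sense-preserving there) and $\Omega_-$ is the region where $|r'|<1$ ($f$ is sense-reversing there). $f$ is called non-degenerate if $r''(z)\ne 0$ for all $z\in\mathcal{C}$; then $\mathcal{C}$ consists of finitely many pairwise disjoint smooth closed Jordan curves, the critical curves. $\mathcal{A}=\{A_1,\dots,A_m\}$ denotes the set of connected components of $\mathbb{C}\setminus\mathcal{C}$; each is contained in $\Omega_+$ or in $\Omega_-$, and on the two sides of a critical curve $f$ is oppositely oriented. The elements of $f(\mathcal{C})$ are the caustic points, and the images of critical curves are the caustics. For $z_0\in\mathcal{C}$, the caustic point $f(z_0)$ is a cusp point if $\operatorname{Re}\big(r''(z_0)/r'(z_0)^{3/2}\big)=0$ and a fold point otherwise. A caustic point $\eta$ is simple if there is exactly one $z\in\mathcal{C}$ with $f(z)=\eta$. For $\eta\in\mathbb{C}$, $f_\eta(z):=f(z)-\eta$. A zero of $f_\eta$ is singular if it lies in $\mathcal{C}$. $N(g;A)$ is the number of zeros of $g$ in $A\subseteq\mathbb{C}$, $N(g):=N(g;\mathbb{C})$, and $N_s(g)$ is the number of singular zeros of $g$. *)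

theory Defs
  imports "HOL-Complex_Analysis.Complex_Analysis" "HOL-Computational_Algebra.Polynomial"
begin

text \<open>
  A rational function \<open>r = p/q\<close> is represented by the pair of polynomials \<open>p, q\<close>
  (coprime, \<open>q \<noteq> 0\<close>).  Because of \<open>x / 0 = 0\<close>, the HOL functions below have meaningless values
  at the poles of \<open>r\<close>, i.e. (for coprime \<open>p, q\<close>) at the zeros of \<open>q\<close>; every set
  defined in terms of those values therefore treats the zeros of \<open>q\<close> explicitly.
\<close>

definition rat_fun :: "complex poly \<Rightarrow> complex poly \<Rightarrow> complex \<Rightarrow> complex" where
  "rat_fun p q z = poly p z / poly q z"

definition rat_degree :: "complex poly \<Rightarrow> complex poly \<Rightarrow> nat" where
  "rat_degree p q = max (degree p) (degree q)"

definition harm_fun :: "complex poly \<Rightarrow> complex poly \<Rightarrow> complex \<Rightarrow> complex" where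
  "harm_fun p q z = rat_fun p q z - cnj z"

definition crit_set :: "complex poly \<Rightarrow> complex poly \<Rightarrow> complex set" where
  "crit_set p q = {z. poly q z \<noteq> 0 \<and> norm (deriv (rat_fun p q) z) = 1}"

definition Omega_plus :: "complex poly \<Rightarrow> complex poly \<Rightarrow> complex set" where
  "Omega_plus p q = {z. poly q z = 0 \<or> norm (deriv (rat_fun p q) z) > 1}"

definition Omega_minus :: "complex poly \<Rightarrow> complex poly \<Rightarrow> complex set" where
  "Omega_minus p q = {z. poly q z \<noteq> 0 \<and> norm (deriv (rat_fun p q) z) < 1}"

definition non_degenerate :: "complex poly \<Rightarrow> complex poly \<Rightarrow> bool" where
  "non_degenerate p q \<longleftrightarrow> (\<forall>z\<in>crit_set p q. deriv (deriv (rat_fun p q)) z \<noteq> 0)"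

text \<open>The set of connected components of the complement of the critical set; poles of \<open>r\<close> belong
  to this complement.\<close>

definition crit_components :: "complex poly \<Rightarrow> complex poly \<Rightarrow> complex set set" where
  "crit_components p q = components (- crit_set p q)"

definition caustic_point :: "complex poly \<Rightarrow> complex poly \<Rightarrow> complex \<Rightarrow> bool" where
  "caustic_point p q \<eta> \<longleftrightarrow> \<eta> \<in> harm_fun p q ` crit_set p q"

text \<open>Replacing the principal branch of the power \<open>3/2\<close> by the other one changes the quotient
  only by a sign, so the condition does not depend on the branch.\<close>

definition cusp_point :: "complex poly \<Rightarrow> complex poly \<Rightarrow> complex \<Rightarrow> bool" where
  "cusp_point p q \<eta> \<longleftrightarrow>
    (\<exists>z\<in>crit_set p q. harm_fun p q z = \<eta> \<and>
      Re (deriv (deriv (rat_fun p q)) z / (deriv (rat_fun p q) z powr (3/2))) = 0)"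

definition fold_point :: "complex poly \<Rightarrow> complex poly \<Rightarrow> complex \<Rightarrow> bool" where
  "fold_point p q \<eta> \<longleftrightarrow> caustic_point p q \<eta> \<and> \<not> cusp_point p q \<eta>"

definition simple_caustic_point :: "complex poly \<Rightarrow> complex poly \<Rightarrow> complex \<Rightarrow> bool" where
  "simple_caustic_point p q \<eta> \<longleftrightarrow> (\<exists>!z. z \<in> crit_set p q \<and> harm_fun p q z = \<eta>)"

text \<open>The zeros of \<open>f\<^sub>\<eta>(z) = r(z) - cnj z - \<eta>\<close> in \<open>A\<close>; they are counted without multiplicity.
  The counts below are meaningful only when the set of zeros is finite, since \<open>card\<close> of an
  infinite set is 0; statements about them assert this finiteness as well.\<close>

definition zeros_in :: "complex poly \<Rightarrow> complex poly \<Rightarrow> complex \<Rightarrow> complex set \<Rightarrow> complex set" where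
  "zeros_in p q \<eta> A = {z\<in>A. poly q z \<noteq> 0 \<and> harm_fun p q z - \<eta> = 0}"

definition num_zeros_in :: "complex poly \<Rightarrow> complex poly \<Rightarrow> complex \<Rightarrow> complex set \<Rightarrow> nat" where
  "num_zeros_in p q \<eta> A = card (zeros_in p q \<eta> A)"

definition num_zeros :: "complex poly \<Rightarrow> complex poly \<Rightarrow> complex \<Rightarrow> nat" where
  "num_zeros p q \<eta> = num_zeros_in p q \<eta> UNIV"

definition num_sing_zeros :: "complex poly \<Rightarrow> complex poly \<Rightarrow> complex \<Rightarrow> nat" where
  "num_sing_zeros p q \<eta> = num_zeros_in p q \<eta> (crit_set p q)"

end

theory Submission
  imports Defs
begin

text \<open>
  No argument principle is needed.  Away from \<open>\<C>\<close> the Jacobian \<open>\<bar>r'\<bar>\<^sup>2 - 1\<close> of \<open>f\<close> does not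
  vanish, so each of the finitely many regular zeros of \<open>f\<^sub>\<eta>\<close> moves to exactly one zero nearby, in
  the same component, while growth at infinity and at the poles prevents zeros from appearing elsewhere.
  At the fold, \<open>f(z) - \<eta> = 2 i y + r''(0) z\<^sup>2 / 2 + \<dots>\<close> for \<open>z = x + i y\<close>, so the zeros
  for a real shift lie on the curve \<open>Im (f - \<eta>) = 0\<close>, which is a graph \<open>y = \<phi>(x)\<close>.  Along it
  \<open>Re (f - \<eta>)\<close> has a strict extremum at \<open>0\<close> with \<open>r\<close> expanding on one side and contracting on the
  other.  Shifting \<open>\<eta>\<close> in the real direction with the sign of \<open>Re (r''(0))\<close> therefore creates one
  zero in each of \<open>\<Omega>\<^sub>+\<close> and \<open>\<Omega>\<^sub>-\<close>, and shifting it the other way removes the zero \<open>0\<close>.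
\<close>

section \<open>Local inversion of harmonic maps\<close>

text \<open>The real Jacobian of \<open>P + cnj Q\<close> is \<open>|P'|^2 - |Q'|^2\<close>, so the
  inverse function theorem applies. Three choices of \<open>Q\<close> occur below: \<open>-z\<close>
  for \<open>f\<close> itself, \<open>0\<close> for a holomorphic chart, and a nontrivial one for
  the fold curve.\<close>

lemma harmonic_locally_invertible:
  fixes P Q :: "complex \<Rightarrow> complex"
  assumes "open S" "P holomorphic_on S" "Q holomorphic_on S" "z0 \<in> S"
    and ne: "norm (deriv P z0) \<noteq> norm (deriv Q z0)"
  obtains U V g where "open U" "U \<subseteq> S" "z0 \<in> U" "open V"
    "homeomorphism U V (\<lambda>z. P z + cnj (Q z)) g"
    "\<And>w. w \<in> V \<Longrightarrow> g differentiable at w"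
proof -
  define B where "B a b = blinfun_mult_right a + (Blinfun cnj o\<^sub>L blinfun_mult_right b)" for a b :: complex
  have B: "blinfun_apply (B a b) h = a * h + cnj (b * h)" for a b h
    by (simp add: B_def plus_blinfun.rep_eq bounded_linear_Blinfun_apply bounded_linear_cnj)
  define D where "D = (norm (deriv P z0))\<^sup>2 - (norm (deriv Q z0))\<^sup>2"
  have D0: "D \<noteq> 0"
    using ne by (simp add: D_def power2_eq_iff_nonneg)
  have D: "of_real D = deriv P z0 * cnj (deriv P z0) - deriv Q z0 * cnj (deriv Q z0)"
    by (simp add: D_def flip: complex_norm_square)
  show thesis
  \<comment> \<open>With \<open>a = deriv P z0\<close> and \<open>b = deriv Q z0\<close>, the
    inverse of the real-linear map \<open>h -> a * h + cnj (b * h)\<close> is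
    \<open>k -> (cnj a * k - cnj (b * k)) / D\<close>, again of the form \<open>B\<close>.\<close>
  proof (rule inverse_function_theorem[of S "\<lambda>z. P z + cnj (Q z)" "\<lambda>z. B (deriv P z) (deriv Q z)"
        z0 "B (cnj (deriv P z0) / D) (- deriv Q z0 / D)"])
    show "((\<lambda>z. P z + cnj (Q z)) has_derivative blinfun_apply (B (deriv P z) (deriv Q z))) (at z)"
      if "z \<in> S" for z
    proof -
      have "(P has_field_derivative deriv P z) (at z)" "(Q has_field_derivative deriv Q z) (at z)"
        using assms that by (auto intro: holomorphic_derivI)
      then have "((\<lambda>z. P z + cnj (Q z)) has_derivative (\<lambda>h. deriv P z * h + cnj (deriv Q z * h))) (at z)"
        unfolding has_field_derivative_def
        by (intro has_derivative_add bounded_linear.has_derivative[OF bounded_linear_cnj]) auto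
      then show ?thesis
        by (simp add: B[abs_def])
    qed
    show "continuous_on S (\<lambda>z. B (deriv P z) (deriv Q z))"
      unfolding B_def
      by (intro continuous_intros bounded_linear.continuous_on[OF bounded_linear_blinfun_mult_right]
          holomorphic_on_imp_continuous_on holomorphic_deriv assms)
    show "B (cnj (deriv P z0) / D) (- deriv Q z0 / D) o\<^sub>L B (deriv P z0) (deriv Q z0) = id_blinfun"
    proof (rule blinfun_eqI)
      fix h
      have "of_real D * blinfun_apply (B (cnj (deriv P z0) / D) (- deriv Q z0 / D) o\<^sub>L B (deriv P z0) (deriv Q z0)) h
         = of_real D * h"
        using D0 unfolding blinfun_apply_blinfun_compose B
        by (simp add: divide_simps) (simp add: D algebra_simps)
      then show "blinfun_apply (B (cnj (deriv P z0) / D) (- deriv Q z0 / D) o\<^sub>L B (deriv P z0) (deriv Q z0)) h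
         = blinfun_apply id_blinfun h"
        using D0 by simp
    qed
  next
    fix U' V g g'
    assume "open U'" "U' \<subseteq> S" "z0 \<in> U'" "open V" "homeomorphism U' V (\<lambda>z. P z + cnj (Q z)) g"
      "\<And>y. y \<in> V \<Longrightarrow> (g has_derivative g' y) (at y)"
    then show thesis
      by (intro that[of U' V g]) (auto simp: differentiable_def)
  qed (use assms in auto)
qed

section \<open>Zeros near a fold\<close>

text \<open>The sign of \<open>H'\<close> makes \<open>H\<close> strictly decreasing left of
  \<open>0\<close> and strictly increasing right of it, so each small positive level is attained
  exactly once on each side. It is applied to the real part of \<open>f\<close> along the fold
  curve.\<close>

lemma valley_solutions:
  fixes H H' :: "real \<Rightarrow> real"
  assumes "d > 0" "H 0 = 0"
    and der: "\<And>x. \<bar>x\<bar> < d \<Longrightarrow> (H has_real_derivative H' x) (at x)"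
    and sgn: "\<And>x. \<bar>x\<bar> < d \<Longrightarrow> x \<noteq> 0 \<Longrightarrow> 0 < x * H' x"
  obtains \<delta> where "\<delta> > 0"
    "\<And>x. \<bar>x\<bar> < d \<Longrightarrow> x \<noteq> 0 \<Longrightarrow> H x > 0"
    "\<And>t. 0 < t \<Longrightarrow> t < \<delta> \<Longrightarrow> \<exists>a b. -d < a \<and> a < 0 \<and> 0 < b \<and> b < d \<and> {x. \<bar>x\<bar> < d \<and> H x = t} = {a, b}"
proof -
  have cont: "continuous_on {a..b} H" if "-d < a" "b < d" for a b
    by (rule DERIV_atLeastAtMost_imp_continuous_on) (use der that in force)
  have inc: "H x < H y" if "0 \<le> x" "x < y" "y < d" for x y
  proof (rule DERIV_pos_imp_increasing_open[where f = H and a = x and b = y])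
    show "\<exists>l. (H has_real_derivative l) (at u) \<and> 0 < l" if "x < u" "u < y" for u
      using der[of u] sgn[of u] that \<open>0 \<le> x\<close> \<open>y < d\<close> by (auto simp: zero_less_mult_iff)
    show "continuous_on {x..y} H"
      using that \<open>d > 0\<close> by (intro cont) auto
  qed (use that in auto)
  have dec: "H y < H x" if "y \<le> 0" "x < y" "- d < x" for x y
  proof (rule DERIV_neg_imp_decreasing_open[where f = H and a = x and b = y])
    show "\<exists>l. (H has_real_derivative l) (at u) \<and> l < 0" if "x < u" "u < y" for u
      using der[of u] sgn[of u] that \<open>y \<le> 0\<close> \<open>-d < x\<close> by (auto simp: zero_less_mult_iff)
    show "continuous_on {x..y} H"
      using that \<open>d > 0\<close> by (intro cont) auto
  qed (use that in auto)
  have pos: "H x > 0" if "\<bar>x\<bar> < d" "x \<noteq> 0" for x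
    using inc[of 0 x] dec[of 0 x] that \<open>H 0 = 0\<close> by (cases "x > 0") auto
  \<comment> \<open>\<open>H\<close> is not controlled at the ends of the interval. Levels below
    both values at half distance are attained by the intermediate value theorem, and monotonicity on
    the whole interval gives uniqueness.\<close>
  define \<delta> where "\<delta> = min (H (d/2)) (H (-d/2))"
  have "\<delta> > 0"
    using pos[of "d/2"] pos[of "-d/2"] \<open>d > 0\<close> by (auto simp: \<delta>_def)
  moreover have "\<exists>a b. -d < a \<and> a < 0 \<and> 0 < b \<and> b < d \<and> {x. \<bar>x\<bar> < d \<and> H x = t} = {a, b}"
    if t: "0 < t" "t < \<delta>" for t
  proof -
    have "\<exists>b\<ge>0. b \<le> d/2 \<and> H b = t"
      using t \<open>d > 0\<close> \<open>H 0 = 0\<close> by (intro IVT' cont) (auto simp: \<delta>_def)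
    then obtain b where b: "0 \<le> b" "b \<le> d/2" "H b = t" by auto
    have "\<exists>a\<ge>-d/2. a \<le> 0 \<and> H a = t"
      using t \<open>d > 0\<close> \<open>H 0 = 0\<close> by (intro IVT2' cont) (auto simp: \<delta>_def)
    then obtain a where a: "-d/2 \<le> a" "a \<le> 0" "H a = t" by auto
    have ne: "a \<noteq> 0" "b \<noteq> 0"
      using a b t \<open>H 0 = 0\<close> by auto
    have "x = a \<or> x = b" if "\<bar>x\<bar> < d" "H x = t" for x
    proof (cases "x \<ge> 0")
      case True
      then show ?thesis
        using inc[of x b] inc[of b x] b that \<open>d > 0\<close> by (cases x b rule: linorder_cases) auto
    next
      case False
      then show ?thesis
        using dec[of x a] dec[of a x] a that \<open>d > 0\<close> by (cases x a rule: linorder_cases) auto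
    qed
    then have "{x. \<bar>x\<bar> < d \<and> H x = t} = {a, b}"
      using a b \<open>d > 0\<close> by auto
    moreover have "-d < a" "a < 0" "0 < b" "b < d"
      using a b ne \<open>d > 0\<close> by auto
    ultimately show ?thesis by blast
  qed
  ultimately show thesis
    by (intro that[of \<delta>] pos) auto
qed

text \<open>At \<open>0\<close> the differential of \<open>f\<close> is
  \<open>h -> h - cnj h\<close>, of rank one, and only \<open>Im f\<close> is a usable coordinate.
  Pairing it with \<open>Re z\<close> gives a map \<open>G\<close> that is locally invertible; the
  curve is the preimage of the real axis under \<open>G\<close>, parametrised by
  \<open>x = Re z\<close>. The bound on \<open>Re (deriv r z)\<close> keeps the later divisor
  \<open>1 + Re r'\<close> positive.\<close>

lemma fold_curve:
  fixes r :: "complex \<Rightarrow> complex"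
  assumes "open S" "r holomorphic_on S" "0 \<in> S" "deriv r 0 = 1"
  obtains U V \<gamma> where "open U" "U \<subseteq> S" "0 \<in> U" "open V" "(0::real) \<in> V"
    "\<And>z. z \<in> U \<Longrightarrow> -1 < Re (deriv r z)"
    "bij_betw \<gamma> V {z\<in>U. Im (r z - cnj z) = Im (r 0)}"
    "\<And>x. x \<in> V \<Longrightarrow> Re (\<gamma> x) = x"
    "\<And>x. x \<in> V \<Longrightarrow> \<gamma> differentiable at x"
proof -
  define T where "T = {z\<in>S. -1 < Re (deriv r z)}"
  \<comment> \<open>\<open>P + cnj Q\<close> equals \<open>z + i * Im (r z - r 0)\<close>: its real
    part is \<open>Re z\<close> and its imaginary part is
    \<open>Im (r z - cnj z) - Im (r 0)\<close>. The derivatives \<open>3/2\<close> and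
    \<open>-1/2\<close> at \<open>0\<close> have different moduli.\<close>
  define P where "P = (\<lambda>z. z + (r z - r 0) / 2)"
  define Q where "Q = (\<lambda>z. (r 0 - r z) / 2)"
  define G where "G = (\<lambda>z. P z + cnj (Q z))"
  have "T = S \<inter> (\<lambda>z. Re (deriv r z)) -` {-1<..}"
    by (auto simp: T_def)
  moreover have "continuous_on S (\<lambda>z. Re (deriv r z))"
    by (intro continuous_intros holomorphic_on_imp_continuous_on holomorphic_deriv assms)
  ultimately have "open T"
    using assms by (simp add: continuous_open_preimage)
  have rT: "r holomorphic_on T"
    using assms by (auto simp: T_def intro: holomorphic_on_subset)
  have "0 \<in> T"
    using assms by (simp add: T_def)
  have r0: "(r has_field_derivative 1) (at 0)"
    using holomorphic_derivI[OF assms(2,1,3)] assms(4) by simp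
  have "(P has_field_derivative 1 + (1 - 0) / 2) (at 0)" "(Q has_field_derivative (0 - 1) / 2) (at 0)"
    unfolding P_def Q_def by (intro derivative_intros DERIV_cdivide r0)+
  then have dP: "deriv P 0 = 3/2" and dQ: "deriv Q 0 = -1/2"
    by (simp_all add: DERIV_imp_deriv)
  have P: "P holomorphic_on T" and Q: "Q holomorphic_on T"
    unfolding P_def Q_def by (intro holomorphic_intros rT; simp)+
  have "norm (deriv P 0) \<noteq> norm (deriv Q 0)"
    unfolding dP dQ by simp
  then obtain U W g where U: "open U" "U \<subseteq> T" "0 \<in> U" and "open W" and hom: "homeomorphism U W G g"
    and g: "\<And>w. w \<in> W \<Longrightarrow> g differentiable at w"
    unfolding G_def by (rule harmonic_locally_invertible[OF \<open>open T\<close> P Q \<open>0 \<in> T\<close>]) blast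
  define V where "V = complex_of_real -` W"
  define \<gamma> where "\<gamma> = g \<circ> complex_of_real"
  have G: "G z = Complex (Re z) (Im (r z - cnj z) - Im (r 0))" for z
    by (simp add: G_def P_def Q_def complex_eq_iff diff_divide_distrib)
  have "G 0 = 0"
    by (simp add: G complex_eq_iff)
  have gU: "g w \<in> U" "G (g w) = w" if "w \<in> W" for w
    using hom that by (auto simp: homeomorphism_def)
  have Gg: "G z \<in> W" "g (G z) = z" if "z \<in> U" for z
    using hom that by (auto simp: homeomorphism_def)
  show thesis
  proof (rule that[of U V \<gamma>])
    show "open V" unfolding V_def
      by (intro open_vimage \<open>open W\<close> continuous_intros)
    show "0 \<in> V"
      using Gg(1)[OF \<open>0 \<in> U\<close>] \<open>G 0 = 0\<close> by (simp add: V_def)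
    show "\<gamma> differentiable at x" if "x \<in> V" for x
      unfolding \<gamma>_def
    proof (rule differentiable_chain_at)
      show "complex_of_real differentiable at x"
        by (simp add: bounded_linear_imp_differentiable bounded_linear_of_real)
      show "g differentiable at (complex_of_real x)"
        using that g by (simp add: V_def)
    qed
    show R: "Re (\<gamma> x) = x" if "x \<in> V" for x
      using gU(2)[of x] that by (simp add: V_def \<gamma>_def G complex_eq_iff)
    show "bij_betw \<gamma> V {z \<in> U. Im (r z - cnj z) = Im (r 0)}"
    proof (rule bij_betw_byWitness[where f' = Re])
      show "\<gamma> ` V \<subseteq> {z \<in> U. Im (r z - cnj z) = Im (r 0)}"
      proof safe
        fix x assume "x \<in> V"
        then have "G (\<gamma> x) = of_real x" "\<gamma> x \<in> U"
          using gU by (auto simp: V_def \<gamma>_def)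
        then show "\<gamma> x \<in> U" "Im (r (\<gamma> x) - cnj (\<gamma> x)) = Im (r 0)"
          by (auto simp: G complex_eq_iff)
      qed
      have *: "G z = of_real (Re z)" if "Im (r z - cnj z) = Im (r 0)" for z
        using that by (simp add: G complex_eq_iff)
      show "\<forall>z\<in>{z \<in> U. Im (r z - cnj z) = Im (r 0)}. \<gamma> (Re z) = z"
        unfolding \<gamma>_def o_def using Gg(2) * by (metis (mono_tags, lifting) mem_Collect_eq)
      show "Re ` {z \<in> U. Im (r z - cnj z) = Im (r 0)} \<subseteq> V"
        unfolding V_def using Gg(1) * by (force simp del: minus_complex.sel)
    qed (use R in auto)
  qed (use U in \<open>auto simp: T_def\<close>)
qed

text \<open>Along the curve \<open>\<gamma>\<close> on which \<open>f - f 0\<close> is real, its derivative is the Jacobian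
  \<open>\<bar>r'\<bar>\<^sup>2 - 1\<close> up to the positive factor \<open>1 / (1 + Re r')\<close>; the Jacobian changes sign at \<open>0\<close>
  because its derivative there is \<open>2 Re (r'' 0)\<close>.\<close>

lemma fold_local_zeros:
  fixes r :: "complex \<Rightarrow> complex"
  assumes "open S" "r holomorphic_on S" "0 \<in> S" "deriv r 0 = 1" "Re (deriv (deriv r) 0) \<noteq> 0"
  obtains D \<delta> and s :: real where "open D" "D \<subseteq> S" "\<delta> > 0" "s \<noteq> 0"
    "{z\<in>D. r z - cnj z = r 0} = {0}"
    "\<And>t. 0 < t \<Longrightarrow> t < \<delta> \<Longrightarrow> \<exists>u v. norm (deriv r u) > 1 \<and> norm (deriv r v) < 1 \<and>
       {z\<in>D. r z - cnj z = r 0 + of_real (s * t)} = {u, v}"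
    "\<And>t. 0 < t \<Longrightarrow> {z\<in>D. r z - cnj z = r 0 - of_real (s * t)} = {}"
proof -
  define r' where "r' = deriv r"
  define c where "c = deriv r' 0"
  obtain U V \<gamma> where U: "open U" "U \<subseteq> S" "0 \<in> U" and V: "open V" "(0::real) \<in> V"
    and r'U: "\<And>z. z \<in> U \<Longrightarrow> -1 < Re (r' z)"
    and bij: "bij_betw \<gamma> V {z\<in>U. Im (r z - cnj z) = Im (r 0)}"
    and Re\<gamma>: "\<And>x. x \<in> V \<Longrightarrow> Re (\<gamma> x) = x"
    and \<gamma>dif: "\<And>x. x \<in> V \<Longrightarrow> \<gamma> differentiable at x"
    using fold_curve[OF assms(1-4)] unfolding r'_def by blast
  have \<gamma>U: "\<gamma> x \<in> U" "Im (r (\<gamma> x) - cnj (\<gamma> x)) = Im (r 0)" if "x \<in> V" for x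
    using bij that by (auto simp: bij_betw_def)
  have nz: "\<gamma> (Re z) = z \<and> Re z \<in> V" if "z \<in> U" "Im (r z - cnj z) = Im (r 0)" for z
  proof -
    have "z \<in> \<gamma> ` V" using that bij by (auto simp: bij_betw_def)
    then show ?thesis using Re\<gamma> by auto
  qed
  define w where "w = (\<lambda>x. vector_derivative \<gamma> (at x))"
  have \<gamma>': "(\<gamma> has_vector_derivative w x) (at x)" if "x \<in> V" for x
    using \<gamma>dif[OF that] by (simp add: w_def vector_derivative_works)
  have r\<gamma>: "((\<lambda>x. r (\<gamma> x) - cnj (\<gamma> x)) has_vector_derivative r' (\<gamma> x) * w x - cnj (w x)) (at x)"
    if "x \<in> V" for x
  proof -
    have "(r has_field_derivative r' (\<gamma> x)) (at (\<gamma> x))"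
      unfolding r'_def by (rule holomorphic_derivI[OF assms(2,1)]) (use U \<gamma>U that in auto)
    from field_vector_diff_chain_at[OF \<gamma>'[OF that] this]
    show ?thesis
      by (intro has_vector_derivative_diff has_vector_derivative_cnj \<gamma>' that) (simp add: o_def mult.commute)
  qed
  have Rew: "Re (w x) = 1" if "x \<in> V" for x
  proof -
    have "((\<lambda>x. Re (\<gamma> x)) has_real_derivative Re (w x)) (at x)"
      using bounded_linear.has_vector_derivative[OF bounded_linear_Re \<gamma>'[OF that]]
      by (simp add: has_real_derivative_iff_has_vector_derivative)
    moreover have "((\<lambda>x. Re (\<gamma> x)) has_real_derivative 1) (at x)"
      by (rule has_field_derivative_transform_within_open[of "\<lambda>x. x" _ _ V]) (use V that Re\<gamma> in \<open>auto intro!: derivative_eq_intros\<close>)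
    ultimately show ?thesis by (rule DERIV_unique)
  qed
  have Imw: "Im (r' (\<gamma> x) * w x) + Im (w x) = 0" if "x \<in> V" for x
  proof -
    have "((\<lambda>x. Im (r (\<gamma> x) - cnj (\<gamma> x))) has_real_derivative Im (r' (\<gamma> x) * w x - cnj (w x))) (at x)"
      using bounded_linear.has_vector_derivative[OF bounded_linear_Im r\<gamma>[OF that]]
      by (simp add: has_real_derivative_iff_has_vector_derivative)
    moreover have "((\<lambda>x. Im (r (\<gamma> x) - cnj (\<gamma> x))) has_real_derivative 0) (at x)"
      by (rule has_field_derivative_transform_within_open[of "\<lambda>x. Im (r 0)" _ _ V]) (use V that \<gamma>U in \<open>auto intro!: derivative_eq_intros\<close>)
    ultimately have "Im (r' (\<gamma> x) * w x - cnj (w x)) = 0" by (rule DERIV_unique)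
    then show ?thesis by simp
  qed
  define h where "h = (\<lambda>x. Re (r (\<gamma> x) - cnj (\<gamma> x)) - Re (r 0))"
  define k where "k = (\<lambda>x. (norm (r' (\<gamma> x)))\<^sup>2 - 1)"
  have h': "(h has_real_derivative k x / (1 + Re (r' (\<gamma> x)))) (at x)" if "x \<in> V" for x
  proof -
    define a b v where "a = Re (r' (\<gamma> x))" and "b = Im (r' (\<gamma> x))" and "v = Im (w x)"
    have h'x: "(h has_real_derivative Re (r' (\<gamma> x) * w x - cnj (w x)) - 0) (at x)"
      using bounded_linear.has_vector_derivative[OF bounded_linear_Re r\<gamma>[OF that]] unfolding h_def
      by (intro DERIV_diff DERIV_const) (simp add: has_real_derivative_iff_has_vector_derivative)
    have "1 + a \<noteq> 0" using r'U[OF \<gamma>U(1)[OF that]] by (simp add: a_def)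
    moreover have "a * v + b + v = 0"
      using Imw[OF that] Rew[OF that] by (simp add: a_def b_def v_def)
    \<comment> \<open>Constancy of the imaginary part along \<open>\<gamma>\<close> gives
      \<open>v * (1 + a) = - b\<close>. Eliminating \<open>v\<close> turns the derivative
      \<open>a - b * v - 1\<close> of \<open>h\<close> into the Jacobian divided by
      \<open>1 + a\<close>.\<close>
    then have "(a - b * v - 1) * (1 + a) = a\<^sup>2 + b\<^sup>2 - 1" by algebra
    ultimately have "a - b * v - 1 = (a\<^sup>2 + b\<^sup>2 - 1) / (1 + a)"
      by (simp add: eq_divide_eq)
    moreover have "Re (r' (\<gamma> x) * w x - cnj (w x)) = a - b * v - 1"
      using Rew[OF that] by (simp add: a_def b_def v_def)
    moreover have "k x = a\<^sup>2 + b\<^sup>2 - 1"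
      by (simp add: k_def a_def b_def cmod_power2)
    ultimately show ?thesis
      using h'x by (simp add: a_def)
  qed
  have "\<gamma> 0 = 0" using nz[of 0] U by simp
  \<comment> \<open>Since \<open>r' 0 = 1\<close>, the relation \<open>Imw\<close> reads
    \<open>2 * Im (w 0) = 0\<close>: the curve passes through \<open>0\<close> horizontally.\<close>
  have "w 0 = 1"
    using Rew[OF V(2)] Imw[OF V(2)] assms(4) by (simp add: \<open>\<gamma> 0 = 0\<close> r'_def complex_eq_iff)
  have k': "(k has_real_derivative 2 * Re c) (at 0)"
  proof -
    have "(r' has_field_derivative c) (at (\<gamma> 0))"
      unfolding r'_def c_def \<open>\<gamma> 0 = 0\<close>
      by (rule holomorphic_derivI[OF _ assms(1,3)]) (use assms in \<open>auto intro: holomorphic_deriv\<close>)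
    from field_vector_diff_chain_at[OF \<gamma>'[OF V(2)] this]
    have *: "((\<lambda>x. r' (\<gamma> x)) has_vector_derivative c) (at 0)"
      by (simp add: o_def \<open>w 0 = 1\<close>)
    have "((\<lambda>x. Re (r' (\<gamma> x))) has_real_derivative Re c) (at 0)"
      "((\<lambda>x. Im (r' (\<gamma> x))) has_real_derivative Im c) (at 0)"
      using bounded_linear.has_vector_derivative[OF bounded_linear_Re *]
       bounded_linear.has_vector_derivative[OF bounded_linear_Im *]
      by (simp_all add: has_real_derivative_iff_has_vector_derivative)
    note [derivative_intros] = this
    show ?thesis unfolding k_def cmod_power2
      by (rule derivative_eq_intros refl | simp add: \<open>\<gamma> 0 = 0\<close> r'_def assms)+
  qed
  \<comment> \<open>Multiplication by the sign of \<open>Re c\<close> turns a maximum of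
    \<open>h\<close> into a minimum, so one valley argument covers both cases; \<open>s\<close> also
    gives the direction of the shift.\<close>
  define s where "s = sgn (Re c)"
  have "Re c \<noteq> 0" using assms by (simp add: c_def r'_def)
  then have s: "s \<noteq> 0" by (simp add: s_def sgn_if)
  have "k 0 = 0" by (simp add: k_def \<open>\<gamma> 0 = 0\<close> r'_def assms)
  have sk': "((\<lambda>x. s * k x) has_real_derivative 2 * \<bar>Re c\<bar>) (at 0)"
    using DERIV_cmult[OF k', of s] by (simp add: s_def abs_sgn algebra_simps)
  have "2 * \<bar>Re c\<bar> > 0" using \<open>Re c \<noteq> 0\<close> by simp
  \<comment> \<open>As \<open>k 0 = 0\<close>, a positive derivative there makes
    \<open>s * k\<close> negative just left of \<open>0\<close> and positive just right of
    it.\<close>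
  from DERIV_pos_inc_right[OF sk' this] DERIV_pos_inc_left[OF sk' this]
  obtain d1 d2 where d12: "d1 > 0" "d2 > 0" "\<And>x. 0 < x \<Longrightarrow> x < d1 \<Longrightarrow> 0 < s * k x"
     "\<And>x. 0 < x \<Longrightarrow> x < d2 \<Longrightarrow> s * k (-x) < 0"
    by (auto simp: \<open>k 0 = 0\<close>)
  obtain e where "e > 0" "ball 0 e \<subseteq> V" using V openE by blast
  define d where "d = min e (min d1 d2)"
  have "d > 0" using d12 \<open>e > 0\<close> by (simp add: d_def)
  have dV: "x \<in> V" if "\<bar>x\<bar> < d" for x
    using that \<open>ball 0 e \<subseteq> V\<close> by (auto simp: d_def)
  have sk: "0 < x * (s * k x)" if "\<bar>x\<bar> < d" "x \<noteq> 0" for x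
    using that d12(3)[of x] d12(4)[of "-x"] by (cases "x > 0") (auto simp: d_def zero_less_mult_iff)
  obtain \<delta> where \<delta>: "\<delta> > 0"
    "\<And>x. \<bar>x\<bar> < d \<Longrightarrow> x \<noteq> 0 \<Longrightarrow> s * h x > 0"
    "\<And>t. 0 < t \<Longrightarrow> t < \<delta> \<Longrightarrow> \<exists>a b. -d < a \<and> a < 0 \<and> 0 < b \<and> b < d \<and> {x. \<bar>x\<bar> < d \<and> s * h x = t} = {a, b}"
  proof (rule valley_solutions[of d "\<lambda>x. s * h x" "\<lambda>x. s * (k x / (1 + Re (r' (\<gamma> x))))"])
    show "((\<lambda>x. s * h x) has_real_derivative s * (k x / (1 + Re (r' (\<gamma> x))))) (at x)"
      if "\<bar>x\<bar> < d" for x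
      by (intro DERIV_cmult h' dV that)
    show "0 < x * (s * (k x / (1 + Re (r' (\<gamma> x)))))" if "\<bar>x\<bar> < d" "x \<noteq> 0" for x
    proof -
      have "1 + Re (r' (\<gamma> x)) > 0" using r'U[OF \<gamma>U(1)[OF dV[OF that(1)]]] by simp
      then have "0 < x * (s * k x) / (1 + Re (r' (\<gamma> x)))" using sk[OF that] by simp
      then show ?thesis by simp
    qed
  qed (use \<open>d > 0\<close> in \<open>auto simp: h_def \<open>\<gamma> 0 = 0\<close>\<close>)
  have h0: "h 0 = 0" by (simp add: h_def \<open>\<gamma> 0 = 0\<close>)
  define D where "D = U \<inter> Re -` {-d<..<d}"
  \<comment> \<open>Stated for every real \<open>t\<close>, so that \<open>t = 0\<close>, positive
    and negative levels yield the unshifted, the two-zero and the zero-free case. The conversion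
    between \<open>h x = s * t\<close> and \<open>s * h x = t\<close> uses
    \<open>s * s = 1\<close>.\<close>
  have zeros: "{z\<in>D. r z - cnj z = r 0 + of_real (s * t)} = \<gamma> ` {x. \<bar>x\<bar> < d \<and> s * h x = t}" for t
  proof -
    have ss: "s * s = 1" using \<open>Re c \<noteq> 0\<close> by (simp add: s_def sgn_if)
    have *: "h x = s * t \<longleftrightarrow> s * h x = t" for x
      using ss by (metis mult.assoc mult_1)
    show ?thesis
    proof (intro set_eqI iffI)
      fix z assume z: "z \<in> {z\<in>D. r z - cnj z = r 0 + of_real (s * t)}"
      then have "r z - cnj z = r 0 + of_real (s * t)" by blast
      then have "Im (r z - cnj z) = Im (r 0)" "Re (r z - cnj z) - Re (r 0) = s * t"
        by (metis Im_complex_of_real add.right_neutral plus_complex.sel(2))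
          (metis Re_complex_of_real add_diff_cancel_left' plus_complex.sel(1) \<open>r z - cnj z = r 0 + of_real (s * t)\<close>)
      moreover have "z \<in> U" using z by (simp add: D_def)
      ultimately have "\<gamma> (Re z) = z" "h (Re z) = s * t"
        unfolding h_def using nz[of z] by metis+
      then show "z \<in> \<gamma> ` {x. \<bar>x\<bar> < d \<and> s * h x = t}"
        using z * by (intro image_eqI[of _ _ "Re z"]) (auto simp: D_def)
    next
      fix z assume "z \<in> \<gamma> ` {x. \<bar>x\<bar> < d \<and> s * h x = t}"
      then obtain x where x: "z = \<gamma> x" "\<bar>x\<bar> < d" "h x = s * t" using * by auto
      then have "r z - cnj z = r 0 + of_real (s * t)"
        unfolding x(1) using \<gamma>U[OF dV[OF x(2)]] by (intro complex_eqI) (auto simp: h_def)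
      then show "z \<in> {z\<in>D. r z - cnj z = r 0 + of_real (s * t)}"
        using x \<gamma>U[OF dV[OF x(2)]] Re\<gamma>[OF dV[OF x(2)]] by (auto simp: D_def)
    qed
  qed
  have k_sgn: "norm (r' (\<gamma> x)) > 1" if "k x > 0" for x
    using that abs_square_le_1[of "norm (r' (\<gamma> x))"] by (simp add: k_def not_le[symmetric])
  have k_sgn': "norm (r' (\<gamma> x)) < 1" if "k x < 0" for x
    using that abs_square_less_1[of "norm (r' (\<gamma> x))"] by (simp add: k_def)
  show thesis
  proof (rule that[of D \<delta> s])
    show "open D" unfolding D_def
      by (intro open_Int U open_vimage open_greaterThanLessThan continuous_intros)
    show "D \<subseteq> S" using U by (auto simp: D_def)
    have "{x. \<bar>x\<bar> < d \<and> s * h x = 0} = {0}"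
      using \<delta>(2) \<open>d > 0\<close> h0 by force
    then show "{z\<in>D. r z - cnj z = r 0} = {0}"
      using zeros[of 0] \<open>\<gamma> 0 = 0\<close> by simp
    have "{x. \<bar>x\<bar> < d \<and> s * h x = -t} = {}" if "t > 0" for t
      using \<delta>(2) that h0 by force
    then show "{z\<in>D. r z - cnj z = r 0 - of_real (s * t)} = {}" if "t > 0" for t
      using zeros[of "-t"] that by simp
    show "\<exists>u v. norm (deriv r u) > 1 \<and> norm (deriv r v) < 1 \<and>
       {z\<in>D. r z - cnj z = r 0 + of_real (s * t)} = {u, v}" if t: "0 < t" "t < \<delta>" for t
    proof -
      obtain a b where ab: "-d < a" "a < 0" "0 < b" "b < d" and eq: "{x. \<bar>x\<bar> < d \<and> s * h x = t} = {a, b}"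
        using \<delta>(3)[OF t] by auto
      have ska: "s * k a < 0" and skb: "s * k b > 0"
        using sk[of a] sk[of b] ab by (auto simp: zero_less_mult_iff)
      have eq': "{z\<in>D. r z - cnj z = r 0 + of_real (s * t)} = {\<gamma> a, \<gamma> b}"
        unfolding zeros eq by simp
      show ?thesis
      \<comment> \<open>The sign of \<open>s\<close> decides which of the two zeros lies on the
        expanding side.\<close>
      proof (cases "s > 0")
        case True
        with ska skb have "k a < 0" "k b > 0" by (auto simp: zero_less_mult_iff mult_less_0_iff)
        then show ?thesis using k_sgn k_sgn' eq' unfolding r'_def
          by (intro exI[of _ "\<gamma> b"] exI[of _ "\<gamma> a"]) auto
      next
        case False
        with ska skb have "k a > 0" "k b < 0" by (auto simp: zero_less_mult_iff mult_less_0_iff)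
        then show ?thesis using k_sgn k_sgn' eq' unfolding r'_def
          by (intro exI[of _ "\<gamma> a"] exI[of _ "\<gamma> b"]) auto
      qed
    qed
  qed (use \<delta> s in auto)
qed

section \<open>The two sides of the critical curve\<close>

text \<open>A logarithm of \<open>\<phi>\<close> is a local chart in which the curve
  \<open>|\<phi>| = 1\<close> becomes the imaginary axis. The sides then correspond to half-discs,
  which are convex. With \<open>\<phi> = r'\<close> this shows that each side near the fold lies in
  a single component.\<close>

lemma cmod_deriv_sides_connected:
  fixes \<phi> :: "complex \<Rightarrow> complex"
  assumes "open S" "\<phi> holomorphic_on S" "z0 \<in> S" "norm (\<phi> z0) = 1" "deriv \<phi> z0 \<noteq> 0"
  obtains N where "open N" "z0 \<in> N" "N \<subseteq> S"
    "connected (N \<inter> {z. norm (\<phi> z) > 1})" "connected (N \<inter> {z. norm (\<phi> z) < 1})"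
proof -
  define c where "c = \<phi> z0"
  have "c \<noteq> 0" "norm c = 1" using assms by (auto simp: c_def)
  \<comment> \<open>Division by \<open>c\<close> moves the value at \<open>z0\<close> to
    \<open>1\<close>, off the branch cut of \<open>Ln\<close>; as \<open>norm c = 1\<close>, the
    real part of the logarithm is still \<open>ln (norm (\<phi> z))\<close>.\<close>
  define T where "T = S \<inter> (\<lambda>z. \<phi> z / c) -` (- \<real>\<^sub>\<le>\<^sub>0)"
  have "continuous_on S (\<lambda>z. \<phi> z / c)"
    using \<open>c \<noteq> 0\<close> by (intro continuous_intros holomorphic_on_imp_continuous_on assms) auto
  then have "open T" unfolding T_def
    by (intro continuous_open_preimage assms open_Compl closed_nonpos_Reals_complex)
  have "z0 \<in> T" using assms \<open>c \<noteq> 0\<close> by (simp add: T_def flip: c_def)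
  define L where "L = (\<lambda>z. Ln (\<phi> z / c))"
  have phiT: "\<phi> holomorphic_on T" using assms(2) by (auto simp: T_def intro: holomorphic_on_subset)
  have L: "L holomorphic_on T"
    unfolding L_def using \<open>c \<noteq> 0\<close> by (intro holomorphic_intros phiT) (auto simp: T_def)
  have "(\<phi> has_field_derivative deriv \<phi> z0) (at z0)"
    using assms by (auto intro: holomorphic_derivI)
  then have "(L has_field_derivative deriv \<phi> z0 / c) (at z0)"
    unfolding L_def using \<open>c \<noteq> 0\<close>
    by (auto intro!: derivative_eq_intros simp flip: c_def)
  then have "deriv L z0 \<noteq> 0"
    using assms \<open>c \<noteq> 0\<close> by (simp add: DERIV_imp_deriv)
  have "norm (deriv L z0) \<noteq> norm (deriv (\<lambda>z. 0) z0)" using \<open>deriv L z0 \<noteq> 0\<close> by simp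
  then obtain U V g where U: "open U" "U \<subseteq> T" "z0 \<in> U" and V: "open V"
    and "homeomorphism U V (\<lambda>z. L z + cnj 0) g"
    by (rule harmonic_locally_invertible[OF \<open>open T\<close> L holomorphic_on_const \<open>z0 \<in> T\<close>])
  then have hom: "homeomorphism U V L g" by simp
  have "L z0 = 0" using \<open>c \<noteq> 0\<close> by (simp add: L_def flip: c_def)
  have Lim: "L ` U = V" "g ` V = U" using hom by (auto simp: homeomorphism_def)
  then have "0 \<in> V" using \<open>L z0 = 0\<close> U by force
  then obtain e where e: "e > 0" "ball 0 e \<subseteq> V" using V openE by blast
  define N where "N = U \<inter> L -` ball 0 e"
  have nrm: "Re (L z) = ln (norm (\<phi> z))" "norm (\<phi> z) > 0" if "z \<in> U" for z
  proof -
    have "\<phi> z \<noteq> 0" using U that by (auto simp: T_def)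
    then show "Re (L z) = ln (norm (\<phi> z))" "norm (\<phi> z) > 0"
      using \<open>c \<noteq> 0\<close> \<open>norm c = 1\<close> by (simp_all add: L_def norm_divide)
  qed
  have im: "N \<inter> {z. Re (L z) \<in> X} = g ` (ball 0 e \<inter> {w. Re w \<in> X})" for X
  proof -
    have gL: "g (L z) = z" if "z \<in> U" for z using hom that by (auto simp: homeomorphism_def)
    have Lg: "L (g w) = w" "g w \<in> U" if "w \<in> V" for w using hom that by (auto simp: homeomorphism_def)
    show ?thesis
      using e gL Lg by (auto simp: N_def intro!: image_eqI)
  qed
  have "connected (g ` (ball 0 e \<inter> {w. Re w \<in> X}))" if "convex (ball 0 e \<inter> {w. Re w \<in> X})" for X
    using that e hom
    by (intro connected_continuous_image convex_connected) (auto simp: homeomorphism_def intro: continuous_on_subset)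
  then have conn: "connected (N \<inter> {z. Re (L z) \<in> X})" if "convex {w. Re w \<in> X}" for X
    using that im by (simp add: convex_Int)
  show thesis
  proof (rule that[of N])
    show "open N" unfolding N_def
      using hom by (intro continuous_open_preimage U) (auto simp: homeomorphism_def)
    show "z0 \<in> N" using U e \<open>L z0 = 0\<close> by (simp add: N_def)
    show "N \<subseteq> S" using U by (auto simp: N_def T_def)
    have "N \<inter> {z. norm (\<phi> z) > 1} = N \<inter> {z. Re (L z) \<in> {0<..}}"
      "N \<inter> {z. norm (\<phi> z) < 1} = N \<inter> {z. Re (L z) \<in> {..<0}}"
      using nrm by (auto simp: N_def)
    then show "connected (N \<inter> {z. norm (\<phi> z) > 1})" "connected (N \<inter> {z. norm (\<phi> z) < 1})"
      using conn[of "{0<..}"] conn[of "{..<0}"] by (simp_all add: convex_halfspace_Re_gt convex_halfspace_Re_lt)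
  qed
qed

section \<open>Location and compactness of the zero sets\<close>

lemma open_nonroots: "open {z::complex. poly q z \<noteq> 0}"
  by (intro open_Collect_neq continuous_intros)

lemma rat_fun_holomorphic: "rat_fun p q holomorphic_on {z. poly q z \<noteq> 0}"
  unfolding rat_fun_def by (intro holomorphic_intros) auto

text \<open>At a pole both sides fail: \<open>zeros_in\<close> excludes it explicitly, while in the
  cleared equation the right-hand side is \<open>0\<close> and \<open>poly p z\<close> is not, by
  coprimality.\<close>

lemma mem_zeros_in_iff:
  assumes "coprime p q"
  shows "z \<in> zeros_in p q \<eta> A \<longleftrightarrow> z \<in> A \<and> poly p z = (cnj z + \<eta>) * poly q z"
proof (cases "poly q z = 0")
  case True
  then have "poly p z \<noteq> 0"
    using assms coprime_poly_0 by blast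
  then show ?thesis
    using True by (simp add: zeros_in_def)
next
  case False
  then show ?thesis
    by (auto simp: zeros_in_def harm_fun_def rat_fun_def field_simps)
qed

text \<open>Clearing the denominator yields an equation that is continuous also at the poles,
  so that only the growth of \<open>f\<close> at infinity matters for compactness.\<close>

lemma zeros_near_zeros:
  assumes "coprime p q"
    and lim: "filterlim (\<lambda>z. norm (harm_fun p q z)) at_top at_infinity"
    and "open D" "zeros_in p q \<eta> UNIV \<subseteq> D"
  obtains m where "m > 0" "\<And>t. norm t < m \<Longrightarrow> zeros_in p q (\<eta> + t) UNIV \<subseteq> D"
proof -
  have "eventually (\<lambda>z. norm \<eta> + 1 \<le> norm (harm_fun p q z)) at_infinity"
    using lim by (simp add: filterlim_at_top)
  then obtain R where R: "\<And>z. norm z \<ge> R \<Longrightarrow> norm \<eta> + 1 \<le> norm (harm_fun p q z)"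
    by (auto simp: eventually_at_infinity)
  define X where "X = cball 0 R - D"
  define H where "H = (\<lambda>z. poly p z - (cnj z + \<eta>) * poly q z)"
  have "compact X"
    unfolding X_def by (intro compact_diff compact_cball \<open>open D\<close>)
  have H0: "H z \<noteq> 0" if "z \<in> X" for z
  proof
    assume "H z = 0"
    then have "z \<in> zeros_in p q \<eta> UNIV"
      by (simp add: mem_zeros_in_iff[OF assms(1)] H_def)
    then show False using that assms(4) unfolding X_def by blast
  qed
  have "continuous_on X H"
    unfolding H_def by (intro continuous_intros)
  moreover have "continuous_on X (poly q)"
    by (intro continuous_intros)
  \<comment> \<open>A zero of the shifted function in \<open>X\<close> satisfies
    \<open>H z = t * poly q z\<close>, that is \<open>t * (poly q z / H z) = 1\<close>. A bound
    \<open>B\<close> on this quotient therefore rules it out once \<open>norm t < 1 / B\<close>; the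
    condition \<open>norm t < 1\<close> keeps all zeros inside radius \<open>R\<close>.\<close>
  ultimately have "continuous_on X (\<lambda>z. poly q z / H z)"
    using H0 by (intro continuous_on_divide) blast+
  then have "bounded ((\<lambda>z. poly q z / H z) ` X)"
    using \<open>compact X\<close> by (intro compact_imp_bounded compact_continuous_image)
  then obtain B where B: "B > 0" "\<And>z. z \<in> X \<Longrightarrow> norm (poly q z / H z) \<le> B"
    unfolding bounded_pos by blast
  show thesis
  proof (rule that[of "min 1 (1 / B)"])
    fix t :: complex assume t: "norm t < min 1 (1 / B)"
    show "zeros_in p q (\<eta> + t) UNIV \<subseteq> D"
    proof
      fix z assume z: "z \<in> zeros_in p q (\<eta> + t) UNIV"
      then have "norm (harm_fun p q z) = norm (\<eta> + t)" by (simp add: zeros_in_def)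
      also have "\<dots> < norm \<eta> + 1" using norm_triangle_ineq[of \<eta> t] t by simp
      finally have "norm z < R" using R[of z] by force
      show "z \<in> D"
      proof (rule ccontr)
        assume "z \<notin> D"
        with \<open>norm z < R\<close> have "z \<in> X" by (simp add: X_def)
        have "H z = t * poly q z"
          using z by (simp add: mem_zeros_in_iff[OF assms(1)] H_def algebra_simps)
        then have "t * (poly q z / H z) = 1"
          using H0[OF \<open>z \<in> X\<close>] by simp
        then have "1 = norm t * norm (poly q z / H z)"
          by (metis norm_mult norm_one)
        also have "\<dots> \<le> norm t * B"
          using B(2)[OF \<open>z \<in> X\<close>] by (intro mult_left_mono) auto
        also have "\<dots> < 1"
          using t B(1) by (simp add: field_simps)
        finally show False by simp
      qed
    qed
  qed (use B in auto)
qed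

text \<open>Closedness comes from the cleared equation, boundedness from growth at infinity.
  Combined with isolation of the zeros this gives finiteness.\<close>

lemma compact_zeros:
  assumes "coprime p q"
    and lim: "filterlim (\<lambda>z. norm (harm_fun p q z)) at_top at_infinity"
  shows "compact (zeros_in p q \<eta> UNIV)"
proof -
  have "eventually (\<lambda>z. norm \<eta> + 1 \<le> norm (harm_fun p q z)) at_infinity"
    using lim by (simp add: filterlim_at_top)
  then obtain R where R: "\<And>z. norm z \<ge> R \<Longrightarrow> norm \<eta> + 1 \<le> norm (harm_fun p q z)"
    by (auto simp: eventually_at_infinity)
  have "norm z \<le> R" if "z \<in> zeros_in p q \<eta> UNIV" for z
    using R[of z] that by (force simp: zeros_in_def)
  then have "bounded (zeros_in p q \<eta> UNIV)"
    by (auto simp: bounded_iff)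
  moreover have "zeros_in p q \<eta> UNIV = {z. poly p z = (cnj z + \<eta>) * poly q z}"
    by (intro set_eqI) (simp add: mem_zeros_in_iff[OF assms(1)])
  moreover have "closed {z. poly p z = (cnj z + \<eta>) * poly q z}"
    by (intro closed_Collect_eq continuous_intros)
  ultimately show ?thesis
    by (simp add: compact_eq_bounded_closed)
qed

section \<open>Persistence of regular zeros\<close>

text \<open>Off the critical set the Jacobian \<open>|r'|^2 - 1\<close> of
  \<open>f = r + cnj (- z)\<close> is nonzero. \<open>D\<close> is chosen inside a ball that avoids
  the critical set; this ball is connected, so a component that meets it contains it.\<close>

lemma regular_point_neighbourhood:
  assumes "poly q z0 \<noteq> 0" "z0 \<notin> crit_set p q" "open W" "z0 \<in> W"
  obtains D where "open D" "z0 \<in> D" "D \<subseteq> W" "D \<inter> crit_set p q = {}"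
    "\<And>z. z \<in> D \<Longrightarrow> poly q z \<noteq> 0"
    "inj_on (harm_fun p q) D" "open (harm_fun p q ` D)"
    "\<And>A z. A \<in> crit_components p q \<Longrightarrow> z \<in> D \<Longrightarrow> z \<in> A \<longleftrightarrow> z0 \<in> A"
proof -
  let ?r = "rat_fun p q"
  define S where "S = {z. poly q z \<noteq> 0}"
  have r: "?r holomorphic_on S" and "open S"
    by (simp_all add: S_def rat_fun_holomorphic open_nonroots)
  then have "continuous_on S (\<lambda>z. norm (deriv ?r z))"
    by (intro continuous_intros holomorphic_on_imp_continuous_on holomorphic_deriv)
  then have "open (S \<inter> (\<lambda>z. norm (deriv ?r z)) -` (- {1}))"
    using \<open>open S\<close> by (intro continuous_open_preimage) auto
  then have "open (W \<inter> (S \<inter> (\<lambda>z. norm (deriv ?r z)) -` (- {1})))"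
    using \<open>open W\<close> by blast
  moreover have "z0 \<in> W \<inter> (S \<inter> (\<lambda>z. norm (deriv ?r z)) -` (- {1}))"
    using assms by (simp add: S_def crit_set_def)
  ultimately obtain e where "e > 0" and e: "ball z0 e \<subseteq> W \<inter> (S \<inter> (\<lambda>z. norm (deriv ?r z)) -` (- {1}))"
    by (rule openE)
  have ball: "ball z0 e \<inter> crit_set p q = {}"
    using e by (auto simp: crit_set_def)
  have "norm (deriv ?r z0) \<noteq> norm (deriv uminus z0)"
    using assms by (simp add: crit_set_def)
  moreover have "?r holomorphic_on ball z0 e" "uminus holomorphic_on ball z0 e"
    using e by (auto intro!: holomorphic_on_subset[OF r] holomorphic_intros)
  ultimately obtain D V g where D: "open D" "D \<subseteq> ball z0 e" "z0 \<in> D" and "open V"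
    and "homeomorphism D V (\<lambda>z. ?r z + cnj (- z)) g"
    using \<open>e > 0\<close> harmonic_locally_invertible[of "ball z0 e" ?r uminus z0] by (metis open_ball centre_in_ball)
  moreover have "(\<lambda>z. ?r z + cnj (- z)) = harm_fun p q"
    by (simp add: harm_fun_def fun_eq_iff)
  ultimately have hom: "homeomorphism D V (harm_fun p q) g" by simp
  show thesis
  proof (rule that[of D])
    show "D \<subseteq> W" "D \<inter> crit_set p q = {}"
      using D(2) e ball by blast+
    show "poly q z \<noteq> 0" if "z \<in> D" for z
      using D(2) e that unfolding S_def by blast
    show "inj_on (harm_fun p q) D"
      by (rule inj_on_inverseI[of _ g]) (use hom in \<open>auto simp: homeomorphism_def\<close>)
    show "open (harm_fun p q ` D)"
      using hom \<open>open V\<close> by (simp add: homeomorphism_def)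
    show "z \<in> A \<longleftrightarrow> z0 \<in> A" if A: "A \<in> crit_components p q" and "z \<in> D" for A z
    proof -
      have "ball z0 e \<subseteq> A" if "A \<inter> ball z0 e \<noteq> {}"
        using components_maximal[of A "- crit_set p q" "ball z0 e"] A ball that
        by (auto simp: crit_components_def)
      then show ?thesis using D \<open>z \<in> D\<close> by blast
    qed
  qed (rule D)+
qed

text \<open>Each of the finitely many zeros outside \<open>D0\<close> has a neighbourhood mapped
  injectively onto an open set around \<open>\<eta>\<close>, so it continues to one zero there, and
  \<open>zeros_near_zeros\<close> excludes zeros elsewhere outside \<open>D0\<close>. The closed set
  \<open>C\<close> shields \<open>D0\<close>: the neighbourhoods avoid \<open>C\<close>, so
  continued zeros cannot enter \<open>D0\<close>.\<close>

lemma regular_zeros_persist: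
  fixes p q \<eta>
  defines "Z \<equiv> zeros_in p q \<eta>"
  assumes "coprime p q"
    and "filterlim (\<lambda>z. norm (harm_fun p q z)) at_top at_infinity"
    and "finite (Z UNIV)" "open D0" "closed C" "D0 \<subseteq> C" "Z UNIV \<inter> C \<subseteq> D0"
    and reg: "(Z UNIV - D0) \<inter> crit_set p q = {}"
  shows "\<exists>m>0. \<forall>t. norm t < m \<longrightarrow>
    (\<forall>A\<in>insert UNIV (insert (crit_set p q) (crit_components p q)).
       finite (zeros_in p q (\<eta> + t) A - D0) \<and> card (zeros_in p q (\<eta> + t) A - D0) = card (Z A - D0))"
proof -
  let ?f = "harm_fun p q"
  define K where "K = Z UNIV - D0"
  have "finite K" using assms by (simp add: K_def)
  \<comment> \<open>Balls whose radius is half this separation are pairwise disjoint.\<close>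
  have "\<exists>\<delta>>0. \<forall>x\<in>K. x \<noteq> z \<longrightarrow> \<delta> \<le> dist z x" for z
    using finite_set_avoid[OF \<open>finite K\<close>] by blast
  then obtain \<rho> where \<rho>: "\<And>z. \<rho> z > 0" "\<And>z x. x \<in> K \<Longrightarrow> x \<noteq> z \<Longrightarrow> \<rho> z \<le> dist z x"
    by metis
  have "\<forall>z\<in>K. \<exists>D. open D \<and> z \<in> D \<and> D \<subseteq> ball z (\<rho> z / 2) - C \<and>
    D \<inter> crit_set p q = {} \<and> (\<forall>w\<in>D. poly q w \<noteq> 0) \<and> inj_on ?f D \<and> open (?f ` D) \<and>
    (\<forall>A\<in>crit_components p q. \<forall>w\<in>D. w \<in> A \<longleftrightarrow> z \<in> A)"
  proof
    fix z assume "z \<in> K"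
    then have z: "poly q z \<noteq> 0" "z \<notin> crit_set p q" "z \<notin> C"
      using reg assms by (auto simp: K_def Z_def zeros_in_def)
    have "open (ball z (\<rho> z / 2) - C)" "z \<in> ball z (\<rho> z / 2) - C"
      using \<rho>(1)[of z] z \<open>closed C\<close> by (auto intro: open_Diff)
    from regular_point_neighbourhood[OF z(1,2) this]
    obtain D where "open D" "z \<in> D" "D \<subseteq> ball z (\<rho> z / 2) - C" "D \<inter> crit_set p q = {}"
      "\<And>w. w \<in> D \<Longrightarrow> poly q w \<noteq> 0" "inj_on ?f D" "open (?f ` D)"
      "\<And>A w. A \<in> crit_components p q \<Longrightarrow> w \<in> D \<Longrightarrow> w \<in> A \<longleftrightarrow> z \<in> A"
      by blast
    then show "\<exists>D. open D \<and> z \<in> D \<and> D \<subseteq> ball z (\<rho> z / 2) - C \<and>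
      D \<inter> crit_set p q = {} \<and> (\<forall>w\<in>D. poly q w \<noteq> 0) \<and> inj_on ?f D \<and> open (?f ` D) \<and>
      (\<forall>A\<in>crit_components p q. \<forall>w\<in>D. w \<in> A \<longleftrightarrow> z \<in> A)"
      by (intro exI[of _ D] conjI ballI)
  qed
  from bchoice[OF this] obtain D where "\<forall>z\<in>K. open (D z) \<and> z \<in> D z \<and> D z \<subseteq> ball z (\<rho> z / 2) - C \<and>
    D z \<inter> crit_set p q = {} \<and> (\<forall>w\<in>D z. poly q w \<noteq> 0) \<and> inj_on ?f (D z) \<and> open (?f ` D z) \<and>
    (\<forall>A\<in>crit_components p q. \<forall>w\<in>D z. w \<in> A \<longleftrightarrow> z \<in> A)" ..
  then have D: "\<And>z. z \<in> K \<Longrightarrow> open (D z)" "\<And>z. z \<in> K \<Longrightarrow> z \<in> D z"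
    "\<And>z. z \<in> K \<Longrightarrow> D z \<subseteq> ball z (\<rho> z / 2) - C"
    "\<And>z. z \<in> K \<Longrightarrow> D z \<inter> crit_set p q = {}"
    "\<And>z w. z \<in> K \<Longrightarrow> w \<in> D z \<Longrightarrow> poly q w \<noteq> 0"
    "\<And>z. z \<in> K \<Longrightarrow> inj_on ?f (D z)" "\<And>z. z \<in> K \<Longrightarrow> open (?f ` D z)"
    and D_comp: "\<And>A z w. z \<in> K \<Longrightarrow> A \<in> crit_components p q \<Longrightarrow> w \<in> D z \<Longrightarrow> w \<in> A \<longleftrightarrow> z \<in> A"
    by blast+
  have disj: "z = y" if "z \<in> K" "y \<in> K" "w \<in> D z" "w \<in> D y" for z y w
  proof (rule ccontr)
    assume "z \<noteq> y"
    have "dist z w < \<rho> z / 2" "dist y w < \<rho> y / 2"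
      using D(3)[OF \<open>z \<in> K\<close>] D(3)[OF \<open>y \<in> K\<close>] that by auto
    moreover have "\<rho> z \<le> dist z y" "\<rho> y \<le> dist y z"
      using \<rho>(2) \<open>z \<noteq> y\<close> that by auto
    ultimately show False
      using dist_triangle2[of z y w] by (simp add: dist_commute)
  qed
  have "open (\<Inter>z\<in>K. ?f ` D z)"
    using \<open>finite K\<close> D(7) by (intro open_INT) auto
  moreover have "\<eta> \<in> (\<Inter>z\<in>K. ?f ` D z)"
  proof
    fix z assume "z \<in> K"
    then have "?f z = \<eta>" "z \<in> D z"
      using D(2) by (auto simp: K_def Z_def zeros_in_def)
    then show "\<eta> \<in> ?f ` D z" by blast
  qed
  ultimately obtain m1 where "m1 > 0" and m1: "ball \<eta> m1 \<subseteq> (\<Inter>z\<in>K. ?f ` D z)"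
    by (rule openE)
  have "open (D0 \<union> (\<Union>z\<in>K. D z))"
    using \<open>open D0\<close> D(1) by auto
  moreover have "zeros_in p q \<eta> UNIV \<subseteq> D0 \<union> (\<Union>z\<in>K. D z)"
    using D(2) by (auto simp: K_def Z_def)
  ultimately obtain m2 where "m2 > 0"
    and m2: "\<And>t. norm t < m2 \<Longrightarrow> zeros_in p q (\<eta> + t) UNIV \<subseteq> D0 \<union> (\<Union>z\<in>K. D z)"
    using zeros_near_zeros[OF assms(2,3)] by metis
  show ?thesis
  proof (intro exI[of _ "min m1 m2"] conjI allI impI ballI)
    fix t :: complex and A
    assume "norm t < min m1 m2" and A: "A \<in> insert UNIV (insert (crit_set p q) (crit_components p q))"
    then have t: "norm t < m1" "norm t < m2" by auto
    \<comment> \<open>For \<open>UNIV\<close> this is trivial, for the critical set both sides are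
      false, and for a component it is \<open>D_comp\<close>; hence one \<open>m\<close> serves all
      \<open>A\<close>.\<close>
    have AD: "w \<in> A \<longleftrightarrow> z \<in> A" if "z \<in> K" "w \<in> D z" for z w
      using D(2,4)[OF \<open>z \<in> K\<close>] D_comp[OF \<open>z \<in> K\<close>] A that by blast
    define \<omega> where "\<omega> = (\<lambda>z. inv_into (D z) ?f (\<eta> + t))"
    have \<omega>: "\<omega> z \<in> D z" "?f (\<omega> z) = \<eta> + t" if "z \<in> K" for z
    proof -
      have "\<eta> + t \<in> ball \<eta> m1" using t by (simp add: dist_norm)
      then have "\<eta> + t \<in> ?f ` D z" using m1 that by blast
      then show "\<omega> z \<in> D z" "?f (\<omega> z) = \<eta> + t"
        unfolding \<omega>_def by (rule inv_into_into, rule f_inv_into_f)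
    qed
    have "bij_betw \<omega> (K \<inter> A) (zeros_in p q (\<eta> + t) A - D0)"
    proof (rule bij_betw_imageI)
      show "inj_on \<omega> (K \<inter> A)"
        by (rule inj_onI) (metis IntD1 \<omega>(1) disj)
      show "\<omega> ` (K \<inter> A) = zeros_in p q (\<eta> + t) A - D0"
      proof (intro equalityI subsetI)
        fix u assume "u \<in> \<omega> ` (K \<inter> A)"
        then obtain z where z: "z \<in> K" "z \<in> A" "u = \<omega> z" by auto
        then show "u \<in> zeros_in p q (\<eta> + t) A - D0"
          using \<omega>[of z] AD[of z u] D(3)[of z] D(5)[of z u] \<open>D0 \<subseteq> C\<close> by (auto simp: zeros_in_def)
      next
        fix u assume u: "u \<in> zeros_in p q (\<eta> + t) A - D0"
        then have "u \<in> zeros_in p q (\<eta> + t) UNIV" by (simp add: zeros_in_def)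
        then obtain z where z: "z \<in> K" "u \<in> D z" using m2[OF t(2)] u by blast
        then have "inj_on ?f (D z)" using D(6) by simp
        moreover have "?f u = \<eta> + t" "u \<in> A" using u by (auto simp: zeros_in_def)
        ultimately have "u = \<omega> z" using \<omega>[OF z(1)] z(2) by (metis inj_onD)
        moreover have "z \<in> K \<inter> A" using AD[OF z] z(1) \<open>u \<in> A\<close> by blast
        ultimately show "u \<in> \<omega> ` (K \<inter> A)" by blast
      qed
    qed
    moreover have KA: "K \<inter> A = Z A - D0" by (auto simp: K_def Z_def zeros_in_def)
    ultimately have bij: "bij_betw \<omega> (Z A - D0) (zeros_in p q (\<eta> + t) A - D0)" by simp
    have "finite (Z A - D0)" unfolding KA[symmetric] using \<open>finite K\<close> by simp
    then show "finite (zeros_in p q (\<eta> + t) A - D0)"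
      using bij_betw_finite[OF bij] by simp
    show "card (zeros_in p q (\<eta> + t) A - D0) = card (Z A - D0)"
      by (rule bij_betw_same_card[OF bij, symmetric])
  qed (use \<open>m1 > 0\<close> \<open>m2 > 0\<close> in auto)
qed

section \<open>Sides of the fold and the final count\<close>

text \<open>\<open>A\<close> accumulates at \<open>z0\<close> and its points in \<open>N\<close> lie
  in \<open>\<Omega>\<close>, so the connected set \<open>N \<inter> \<Omega>\<close> meets
  \<open>A\<close> and is absorbed by maximality. This tells which components receive the new
  zeros.\<close>

lemma near_critical_point_subset_side:
  assumes A: "A \<in> components (- C)" and "z0 \<in> frontier A" "open N" "z0 \<in> N"
    and "A \<inter> N \<subseteq> \<Omega>" "N \<inter> \<Omega> \<inter> C = {}" "connected (N \<inter> \<Omega>)"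
  shows "N \<inter> \<Omega> \<subseteq> A"
proof (rule components_maximal[OF A])
  have "z0 \<in> closure A" using assms(2) by (simp add: frontier_def)
  then have "A \<inter> N \<noteq> {}"
    using assms(3,4) open_Int_closure_eq_empty[of N A] by blast
  then show "A \<inter> (N \<inter> \<Omega>) \<noteq> {}" using assms(5) by blast
qed (use assms in auto)

theorem theorem4p3:
  fixes p q :: "complex poly" and \<eta> :: complex and A_plus A_minus :: "complex set"
  assumes "q \<noteq> 0" and "coprime p q" and "rat_degree p q \<ge> 2"
    and "non_degenerate p q"
    and "filterlim (\<lambda>z. norm (harm_fun p q z)) at_top at_infinity"
    and "poly q 0 \<noteq> 0" and "deriv (rat_fun p q) 0 = 1"
    and "\<eta> = harm_fun p q 0"
    and "simple_caustic_point p q \<eta>" and "fold_point p q \<eta>"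
    and "A_plus \<in> crit_components p q" and "A_minus \<in> crit_components p q"
    and "0 \<in> frontier A_plus \<inter> frontier A_minus"
    and "A_plus \<subseteq> Omega_plus p q" and "A_minus \<subseteq> Omega_minus p q"
  shows "\<exists>\<eta>'::complex. \<eta>' \<noteq> 0 \<and> (\<forall>\<alpha>::real. 0 < \<alpha> \<and> \<alpha> \<le> 1 \<longrightarrow>
    (let \<eta>p = \<eta> + of_real \<alpha> * \<eta>'; \<eta>m = \<eta> - of_real \<alpha> * \<eta>' in
      (finite (zeros_in p q \<eta>p UNIV) \<and> finite (zeros_in p q \<eta> UNIV) \<and>
        finite (zeros_in p q \<eta>m UNIV)) \<and>
      (num_zeros p q \<eta>p = num_zeros p q \<eta> + 1 \<and>
        num_zeros p q \<eta> + 1 = num_zeros p q \<eta>m + 2) \<and>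
      (\<forall>A\<in>crit_components p q - {A_plus, A_minus}.
        num_zeros_in p q \<eta>p A = num_zeros_in p q \<eta> A \<and>
        num_zeros_in p q \<eta> A = num_zeros_in p q \<eta>m A) \<and>
      num_zeros_in p q \<eta>p A_plus = num_zeros_in p q \<eta>m A_plus + 1 \<and>
      num_zeros_in p q \<eta>p A_minus = num_zeros_in p q \<eta>m A_minus + 1 \<and>
      (num_sing_zeros p q \<eta>p = 0 \<and> num_sing_zeros p q \<eta>m = 0 \<and> num_sing_zeros p q \<eta> = 1)))"
proof -
  let ?r = "rat_fun p q" and ?C = "crit_set p q" and ?Z = "zeros_in p q"
  define S where "S = {z. poly q z \<noteq> 0}"
  have S: "open S" "?r holomorphic_on S" "0 \<in> S"
    using assms(6) by (simp_all add: S_def open_nonroots rat_fun_holomorphic)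
  have "0 \<in> ?C" using assms by (simp add: crit_set_def)
  have \<eta>: "\<eta> = ?r 0" using assms(8) by (simp add: harm_fun_def)
  have "\<not> cusp_point p q \<eta>" using assms(10) by (simp add: fold_point_def)
  then have c: "Re (deriv (deriv ?r) 0) \<noteq> 0"
    using \<open>0 \<in> ?C\<close> assms(7,8) by (auto simp: cusp_point_def)
  have f: "harm_fun p q z = x \<longleftrightarrow> ?r z - cnj z = x" for z x
    by (simp add: harm_fun_def)
  have sing: "?Z \<eta> UNIV \<inter> ?C = {0}"
    using assms(8,9) \<open>0 \<in> ?C\<close> unfolding simple_caustic_point_def zeros_in_def crit_set_def by auto

  \<comment> \<open>The zeros form a compact set of isolated points: local injectivity isolates the
    regular ones, the fold analysis isolates \<open>0\<close>.\<close>
  have "finite (?Z \<eta> UNIV \<inter> ?Z \<eta> UNIV)"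
  proof (rule finite_not_islimpt_in_compact)
    show "compact (?Z \<eta> UNIV)" by (rule compact_zeros[OF assms(2,5)])
    fix z assume z: "z \<in> ?Z \<eta> UNIV"
    have "\<exists>D. open D \<and> z \<in> D \<and> ?Z \<eta> UNIV \<inter> D \<subseteq> {z}"
    proof (cases "z \<in> ?C")
      case True
      then have "z = 0" using z sing by blast
      obtain D where "open D" "{z\<in>D. ?r z - cnj z = ?r 0} = {0}"
        using fold_local_zeros[OF S assms(7) c] by metis
      then show ?thesis
        using \<open>z = 0\<close> by (intro exI[of _ D]) (auto simp: zeros_in_def f \<eta>)
    next
      case False
      have "poly q z \<noteq> 0" using z by (simp add: zeros_in_def)
      then obtain D where "open D" "z \<in> D" and inj: "inj_on (harm_fun p q) D"
        using regular_point_neighbourhood[OF _ False open_UNIV UNIV_I] by metis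
      have "w = z" if "w \<in> ?Z \<eta> UNIV" "w \<in> D" for w
        using inj_onD[OF inj, of w z] z that \<open>z \<in> D\<close> by (simp add: zeros_in_def)
      then show ?thesis using \<open>open D\<close> \<open>z \<in> D\<close> by blast
    qed
    then show "\<not> z islimpt ?Z \<eta> UNIV"
      by (meson IntI insertE empty_iff islimptE subsetD)
  qed
  then have fin: "finite (?Z \<eta> UNIV)" by simp

  have "deriv ?r holomorphic_on S" using S by (intro holomorphic_deriv)
  moreover have "norm (deriv ?r 0) = 1" "deriv (deriv ?r) 0 \<noteq> 0" using assms(7) c by auto
  ultimately obtain N where N: "open N" "0 \<in> N" "N \<subseteq> S"
    "connected (N \<inter> {z. norm (deriv ?r z) > 1})" "connected (N \<inter> {z. norm (deriv ?r z) < 1})"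
    using cmod_deriv_sides_connected[OF S(1) _ S(3)] by metis
  have Np: "N \<inter> {z. norm (deriv ?r z) > 1} \<subseteq> A_plus"
    by (rule near_critical_point_subset_side[of _ ?C 0])
      (use N assms in \<open>auto simp: crit_components_def crit_set_def Omega_plus_def S_def\<close>)
  have Nm: "N \<inter> {z. norm (deriv ?r z) < 1} \<subseteq> A_minus"
    by (rule near_critical_point_subset_side[of _ ?C 0])
      (use N assms in \<open>auto simp: crit_components_def crit_set_def Omega_minus_def S_def\<close>)

  obtain e where "e > 0" and e: "\<And>w. w \<in> ball 0 e \<Longrightarrow> w \<in> N \<and> (w \<noteq> 0 \<longrightarrow> w \<notin> ?Z \<eta> UNIV)"
    using finite_ball_avoid[OF N(1) fin N(2)] by blast
  \<comment> \<open>Within radius \<open>e\<close> the only zero of the unshifted function is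
    \<open>0\<close>. Halving the radius makes \<open>cball 0 (e/2)\<close> the closed shield for
    \<open>regular_zeros_persist\<close>; intersecting with \<open>N\<close> places the new zeros in
    \<open>A_plus\<close> and \<open>A_minus\<close>.\<close>
  define B where "B = ball 0 (e/2) \<inter> N"
  have B: "open B" "?r holomorphic_on B" "0 \<in> B"
    using N S \<open>e > 0\<close> by (auto simp: B_def intro: holomorphic_on_subset)
  obtain D \<delta> and s :: real where D: "open D" "D \<subseteq> B" "\<delta> > 0" "s \<noteq> 0"
    and D0: "{z\<in>D. ?r z - cnj z = \<eta>} = {0}"
    and Dp: "\<And>t. 0 < t \<Longrightarrow> t < \<delta> \<Longrightarrow> \<exists>u v. norm (deriv ?r u) > 1 \<and> norm (deriv ?r v) < 1 \<and>
       {z\<in>D. ?r z - cnj z = \<eta> + of_real (s * t)} = {u, v}"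
    and Dm: "\<And>t. 0 < t \<Longrightarrow> {z\<in>D. ?r z - cnj z = \<eta> - of_real (s * t)} = {}"
    using fold_local_zeros[OF B assms(7) c, folded \<eta>] by blast
  have Z_D: "?Z x A \<inter> D = {z\<in>D. ?r z - cnj z = x} \<inter> A" for x A
    using D N by (auto simp: zeros_in_def f B_def S_def)

  have "0 \<in> {z\<in>D. ?r z - cnj z = \<eta>}" unfolding D0 by simp
  then have "0 \<in> D" by simp
  have "w \<in> ball 0 e" if "w \<in> cball 0 (e/2)" for w :: complex
    using that \<open>e > 0\<close> by simp
  then have Z_near: "?Z \<eta> UNIV \<inter> cball 0 (e/2) \<subseteq> D" using e \<open>0 \<in> D\<close> by blast
  have Z_reg: "(?Z \<eta> UNIV - D) \<inter> ?C = {}"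
  proof -
    have "(?Z \<eta> UNIV - D) \<inter> ?C \<subseteq> {0} - D" unfolding sing[symmetric] by blast
    then show ?thesis using \<open>0 \<in> D\<close> by simp
  qed
  have D_small: "D \<subseteq> cball 0 (e/2)" using D(2) by (auto simp: B_def)
  obtain m where "m > 0" and m:
    "\<And>t A. norm t < m \<Longrightarrow> A \<in> insert UNIV (insert ?C (crit_components p q)) \<Longrightarrow>
       finite (?Z (\<eta> + t) A - D) \<and> card (?Z (\<eta> + t) A - D) = card (?Z \<eta> A - D)"
    using regular_zeros_persist[OF assms(2,5) fin D(1) closed_cball D_small Z_near Z_reg] by blast

  \<comment> \<open>The zeros outside \<open>D\<close>, whose number is unaffected by small shifts;
    \<open>count\<close> adds the zeros inside \<open>D\<close>.\<close>
  define n where "n = (\<lambda>A. card (?Z \<eta> A - D))"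
  have count: "finite (?Z (\<eta> + t) A) \<and> num_zeros_in p q (\<eta> + t) A = n A + card ({z\<in>D. ?r z - cnj z = \<eta> + t} \<inter> A)"
    if "norm t < m" "A \<in> insert UNIV (insert ?C (crit_components p q))" "finite {z\<in>D. ?r z - cnj z = \<eta> + t}"
    for t A
  proof -
    have "?Z (\<eta> + t) A = (?Z (\<eta> + t) A - D) \<union> ({z\<in>D. ?r z - cnj z = \<eta> + t} \<inter> A)"
      using Z_D[of "\<eta> + t" A] by blast
    then have *: "finite (?Z (\<eta> + t) A)"
      using m[OF that(1,2)] that(3) by (metis finite_Int finite_UnI)
    then show ?thesis
      using card_Int_Diff[OF *, of D] m[OF that(1,2)] by (simp add: num_zeros_in_def n_def Z_D)
  qed

  have comp_disj: "A \<inter> A' = {}" if "A \<in> crit_components p q" "A' \<in> crit_components p q" "A \<noteq> A'" for A A'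
    using that components_nonoverlap[of A "- ?C" A'] by (simp add: crit_components_def)
  have comp_C: "A \<inter> ?C = {}" if "A \<in> crit_components p q" for A
    using in_components_subset[of A "- ?C"] that by (auto simp: crit_components_def)
  have pm: "A_plus \<inter> A_minus = {}"
    using assms(14,15) by (force simp: Omega_plus_def Omega_minus_def)

  \<comment> \<open>Halving makes the bounds strict, so every shift with
    \<open>\<alpha> \<le> 1\<close> stays within the ranges of both the fold analysis and
    \<open>count\<close>.\<close>
  define \<kappa> where "\<kappa> = min \<delta> (m / \<bar>s\<bar>) / 2"
  have \<kappa>: "\<kappa> > 0" "\<kappa> < \<delta>" "\<bar>s\<bar> * \<kappa> < m"
  proof -
    define x where "x = m / \<bar>s\<bar>"
    have "0 < x" "x * \<bar>s\<bar> = m" using D(4) \<open>m > 0\<close> by (simp_all add: x_def)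
    moreover have "\<kappa> = min \<delta> x / 2" by (simp add: \<kappa>_def x_def)
    ultimately have \<kappa>: "0 < \<kappa>" "\<kappa> < \<delta>" "\<kappa> < x" using D(3) by linarith+
    then show "\<kappa> > 0" "\<kappa> < \<delta>" by auto
    show "\<bar>s\<bar> * \<kappa> < m"
      unfolding \<open>x * \<bar>s\<bar> = m\<close>[symmetric] using D(4) \<kappa>(3) by simp
  qed
  show ?thesis
  proof (intro exI[of _ "complex_of_real (s * \<kappa>)"] conjI allI impI)
    show "complex_of_real (s * \<kappa>) \<noteq> 0" using D(4) \<kappa>(1) by simp
    fix \<alpha> :: real assume \<alpha>: "0 < \<alpha> \<and> \<alpha> \<le> 1"
    define t where "t = \<alpha> * \<kappa>"
    have "t \<le> \<kappa>" using \<alpha> \<kappa> by (simp add: t_def mult_left_le_one_le)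
    moreover have "\<bar>s\<bar> * t \<le> \<bar>s\<bar> * \<kappa>" using \<open>t \<le> \<kappa>\<close> by (intro mult_left_mono) auto
    moreover have "0 < t" using \<alpha> \<kappa> by (simp add: t_def)
    ultimately have t: "0 < t" "t < \<delta>" "\<bar>s\<bar> * t < m" using \<kappa> by simp_all
    define \<tau> where "\<tau> = complex_of_real (s * t)"
    have \<tau>: "norm \<tau> < m" "norm (- \<tau>) < m"
      using t by (simp_all add: \<tau>_def norm_mult)
    obtain u v where uv: "norm (deriv ?r u) > 1" "norm (deriv ?r v) < 1"
      and Duv: "{z\<in>D. ?r z - cnj z = \<eta> + \<tau>} = {u, v}"
      using Dp[OF t(1,2)] unfolding \<tau>_def by blast
    have "{u, v} \<subseteq> D" unfolding Duv[symmetric] by simp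
    then have "u \<in> N" "v \<in> N" using D(2) by (auto simp: B_def)
    then have uvA: "u \<in> A_plus" "v \<in> A_minus" "u \<noteq> v" using Np Nm uv by auto
    \<comment> \<open>Inside \<open>D\<close> there are two zeros for the shift
      \<open>\<tau>\<close>, none for \<open>- \<tau>\<close> and one for no shift.\<close>
    have cp: "finite (?Z (\<eta> + \<tau>) A)"
      "num_zeros_in p q (\<eta> + \<tau>) A = n A + card ({u, v} \<inter> A)"
      if "A \<in> insert UNIV (insert ?C (crit_components p q))" for A
      using count[OF \<tau>(1) that] unfolding Duv by simp_all
    have cm: "finite (?Z (\<eta> - \<tau>) A)"
      "num_zeros_in p q (\<eta> - \<tau>) A = n A"
      if "A \<in> insert UNIV (insert ?C (crit_components p q))" for A
      using count[OF \<tau>(2) that] Dm[OF t(1), folded \<tau>_def] by simp_all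
    have c0: "finite (?Z \<eta> A)" "num_zeros_in p q \<eta> A = n A + card ({0} \<inter> A)"
      if "A \<in> insert UNIV (insert ?C (crit_components p q))" for A
      using count[of 0 A] that \<open>m > 0\<close> by (simp_all add: D0)
    have eq: "of_real \<alpha> * complex_of_real (s * \<kappa>) = \<tau>"
      by (simp add: t_def \<tau>_def)
    \<comment> \<open>All singular zeros are thus counted inside \<open>D\<close>, where
      \<open>0\<close> is singular and \<open>u\<close>, \<open>v\<close> are not.\<close>
    have nC: "n ?C = 0"
    proof -
      have "?Z \<eta> ?C - D = (?Z \<eta> UNIV - D) \<inter> ?C" by (auto simp: zeros_in_def)
      then have "?Z \<eta> ?C - D = {}" unfolding Z_reg .
      then show ?thesis unfolding n_def by (metis card.empty)
    qed
    have uvC: "{u, v} \<inter> ?C = {}" using uvA comp_C assms(11,12) by blast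
    have uvp: "{u, v} \<inter> A_plus = {u}" "{u, v} \<inter> A_minus = {v}" using uvA pm by auto
    have uvo: "{u, v} \<inter> A = {}" "{0} \<inter> A = {}" if "A \<in> crit_components p q - {A_plus, A_minus}" for A
      using that uvA comp_disj assms(11,12) comp_C[of A] \<open>0 \<in> ?C\<close> by blast+
    show "let \<eta>p = \<eta> + of_real \<alpha> * of_real (s * \<kappa>); \<eta>m = \<eta> - of_real \<alpha> * of_real (s * \<kappa>) in
      (finite (zeros_in p q \<eta>p UNIV) \<and> finite (zeros_in p q \<eta> UNIV) \<and>
        finite (zeros_in p q \<eta>m UNIV)) \<and>
      (num_zeros p q \<eta>p = num_zeros p q \<eta> + 1 \<and>
        num_zeros p q \<eta> + 1 = num_zeros p q \<eta>m + 2) \<and>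
      (\<forall>A\<in>crit_components p q - {A_plus, A_minus}.
        num_zeros_in p q \<eta>p A = num_zeros_in p q \<eta> A \<and>
        num_zeros_in p q \<eta> A = num_zeros_in p q \<eta>m A) \<and>
      num_zeros_in p q \<eta>p A_plus = num_zeros_in p q \<eta>m A_plus + 1 \<and>
      num_zeros_in p q \<eta>p A_minus = num_zeros_in p q \<eta>m A_minus + 1 \<and>
      (num_sing_zeros p q \<eta>p = 0 \<and> num_sing_zeros p q \<eta>m = 0 \<and> num_sing_zeros p q \<eta> = 1)"
      unfolding eq Let_def num_zeros_def num_sing_zeros_def
      using assms(11,12) \<open>u \<noteq> v\<close> \<open>0 \<in> ?C\<close>
      by (simp add: cp cm c0 nC uvC uvp uvo)
  qed
qed

end
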